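(* Let $f,g\in\mathcal F$ be randomly chosen Möbius transformations (chosen independently). Then the probability that the group $\langle f,g\rangle$ is discrete is no more than $\frac14$.
   Context: $\mathbb S$ is the unit circle in $\mathbb C$. $\mathcal F$ is the group of matrices $A=\pm\begin{pmatrix} a & c\\ \bar c & \bar a\end{pmatrix}\in PSL(2,\mathbb C)$ with $a,c\in\mathbb C$, $|a|^2-|c|^2=1$, identified with the group of Möbius transformations $f(z)=\frac{az+c}{\bar c z+\bar a}$ preserving $\mathbb S$ and the unit disk. A random element of $\mathcal F$ is obtained by choosing, independently, $a/|a|$ and $c/|c|$ uniformly on $\mathbb S$ with respect to arclength, and $|a|\ge 1$ such that $2\arcsin(1/|a|)$ is uniformly distributed in $[0,\pi]$, with $|c|=\sqrt{|a|^2-1}$. *)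

theory Defs
  imports "HOL-Probability.Probability" "HOL-Algebra.Generated_Groups"
begin

section \<open>The topological group PSL(2,C)\<close>

type_synonym cmat2 = "complex ^ 2 ^ 2"

definition SL2C :: "cmat2 monoid" where
  "SL2C = \<lparr>carrier = {A. det A = 1}, mult = (\<lambda>A B. A ** B), one = mat 1\<rparr>"

definition PSL2C :: "cmat2 set monoid" where
  "PSL2C = SL2C Mod {mat 1, - mat 1}"

definition to_PSL2C :: "cmat2 \<Rightarrow> cmat2 set" where
  "to_PSL2C A = {mat 1, - mat 1} #>\<^bsub>SL2C\<^esub> A"

text \<open>The quotient topology; see \<open>quotient_map_to_PSL2C\<close>.\<close>

definition PSL2C_topology :: "cmat2 set topology" where
  "PSL2C_topology = topology (\<lambda>U. U \<subseteq> carrier PSL2C \<and>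
     openin (top_of_set (carrier SL2C)) {A \<in> carrier SL2C. to_PSL2C A \<in> U})"

definition discrete_in_PSL2C :: "cmat2 set set \<Rightarrow> bool" where
  "discrete_in_PSL2C G \<longleftrightarrow> subtopology PSL2C_topology G = discrete_topology G"

lemma to_PSL2C_eq: "to_PSL2C A = {A, - A}"
proof -
  have "(- mat 1) ** A = - A"
    by (simp add: matrix_matrix_mult_def mat_def vec_eq_iff if_distrib if_distribR sum_negf cong: if_cong)
  then show ?thesis
    by (auto simp: to_PSL2C_def r_coset_def SL2C_def)
qed

lemma carrier_PSL2C: "carrier PSL2C = to_PSL2C ` carrier SL2C"
  by (simp add: PSL2C_def to_PSL2C_def carrier_FactGroup)

lemma group_SL2C: "Group.group SL2C"
proof (rule groupI)
  fix A assume "A \<in> carrier SL2C"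
  then have A: "det A = 1" by (simp add: SL2C_def)
  then have "invertible A" by (simp add: invertible_det_nz)
  then obtain B where B: "A ** B = mat 1" "B ** A = mat 1" by (auto simp: invertible_def)
  have "det B * det A = 1" using B(2) by (metis det_I det_mul)
  then show "\<exists>B\<in>carrier SL2C. B \<otimes>\<^bsub>SL2C\<^esub> A = \<one>\<^bsub>SL2C\<^esub>"
    using A B(2) by (auto simp: SL2C_def)
qed (auto simp: SL2C_def det_mul matrix_mul_assoc)

lemma matrix_mult_uminus_left: "(- A) ** B = - (A ** B)" for A B :: cmat2
  by (simp add: matrix_matrix_mult_def vec_eq_iff sum_negf)

lemma matrix_mult_uminus_right: "A ** (- B) = - (A ** B)" for A B :: cmat2
  by (simp add: matrix_matrix_mult_def vec_eq_iff sum_negf)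

lemma normal_SL2C: "{mat 1, - mat 1} \<lhd> SL2C"
proof -
  interpret Group.group SL2C by (rule group_SL2C)
  have mone: "- mat 1 \<in> carrier SL2C"
    by (simp add: SL2C_def det_2 mat_def)
  have sub: "subgroup {mat 1, - mat 1} SL2C"
  proof (rule subgroupI)
    have "inv\<^bsub>SL2C\<^esub> (- mat 1) = - mat 1"
      by (rule inv_equality) (use mone in \<open>simp_all add: SL2C_def matrix_mult_uminus_left\<close>)
    moreover have "inv\<^bsub>SL2C\<^esub> (mat 1) = mat 1"
      using inv_one by (simp add: SL2C_def)
    ultimately show "inv\<^bsub>SL2C\<^esub> a \<in> {mat 1, - mat 1}" if "a \<in> {mat 1, - mat 1}" for a
      using that by auto
  qed (use mone in \<open>auto simp: SL2C_def matrix_mult_uminus_left matrix_mult_uminus_right\<close>)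
  show ?thesis
  proof (rule normalI[OF sub], rule ballI)
    fix A
    show "{mat 1, - mat 1} #>\<^bsub>SL2C\<^esub> A = A <#\<^bsub>SL2C\<^esub> {mat 1, - mat 1}"
      by (auto simp: r_coset_def l_coset_def SL2C_def matrix_mult_uminus_left matrix_mult_uminus_right)
  qed
qed

lemma group_PSL2C: "Group.group PSL2C"
  unfolding PSL2C_def by (rule normal.factorgroup_is_group[OF normal_SL2C])

lemma mult_to_PSL2C:
  assumes "A \<in> carrier SL2C" "B \<in> carrier SL2C"
  shows "to_PSL2C A \<otimes>\<^bsub>PSL2C\<^esub> to_PSL2C B = to_PSL2C (A ** B)"
  using normal.rcos_sum[OF normal_SL2C assms]
  by (simp add: PSL2C_def to_PSL2C_def SL2C_def)

lemma openin_PSL2C_topology: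
  "openin PSL2C_topology U \<longleftrightarrow> U \<subseteq> carrier PSL2C \<and>
     openin (top_of_set (carrier SL2C)) {A \<in> carrier SL2C. to_PSL2C A \<in> U}"
proof -
  have "istopology (\<lambda>U. U \<subseteq> carrier PSL2C \<and>
     openin (top_of_set (carrier SL2C)) {A \<in> carrier SL2C. to_PSL2C A \<in> U})"
    unfolding istopology_def
  proof (intro conjI allI impI)
    fix S T
    assume "S \<subseteq> carrier PSL2C \<and> openin (top_of_set (carrier SL2C)) {A \<in> carrier SL2C. to_PSL2C A \<in> S}"
      and "T \<subseteq> carrier PSL2C \<and> openin (top_of_set (carrier SL2C)) {A \<in> carrier SL2C. to_PSL2C A \<in> T}"
    then have "openin (top_of_set (carrier SL2C))
        ({A \<in> carrier SL2C. to_PSL2C A \<in> S} \<inter> {A \<in> carrier SL2C. to_PSL2C A \<in> T})"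
      by (intro openin_Int) auto
    then show "openin (top_of_set (carrier SL2C)) {A \<in> carrier SL2C. to_PSL2C A \<in> S \<inter> T}"
      by (rule back_subst[where P = "openin _"]) auto
  next
    fix K
    assume K: "\<forall>U\<in>K. U \<subseteq> carrier PSL2C \<and>
      openin (top_of_set (carrier SL2C)) {A \<in> carrier SL2C. to_PSL2C A \<in> U}"
    then have "openin (top_of_set (carrier SL2C)) (\<Union>U\<in>K. {A \<in> carrier SL2C. to_PSL2C A \<in> U})"
      by (intro openin_Union) auto
    then show "openin (top_of_set (carrier SL2C)) {A \<in> carrier SL2C. to_PSL2C A \<in> \<Union>K}"
      by (rule back_subst[where P = "openin _"]) auto
  qed auto
  then show ?thesis
    by (simp add: PSL2C_topology_def topology_inverse')
qed

lemma topspace_PSL2C_topology: "topspace PSL2C_topology = carrier PSL2C"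
proof
  show "topspace PSL2C_topology \<subseteq> carrier PSL2C"
    by (meson openin_PSL2C_topology openin_topspace)
  have "{A \<in> carrier SL2C. to_PSL2C A \<in> carrier PSL2C} = carrier SL2C"
    by (auto simp: carrier_PSL2C)
  then have "openin PSL2C_topology (carrier PSL2C)"
    using openin_topspace[of "top_of_set (carrier SL2C)"]
    by (simp add: openin_PSL2C_topology)
  then show "carrier PSL2C \<subseteq> topspace PSL2C_topology"
    by (rule openin_subset)
qed

lemma quotient_map_to_PSL2C:
  "quotient_map (top_of_set (carrier SL2C)) PSL2C_topology to_PSL2C"
  by (auto simp: quotient_map_def topspace_PSL2C_topology carrier_PSL2C openin_PSL2C_topology)


section \<open>The group of Moebius transformations preserving the unit disk\<close>

definition disk_matrix :: "complex \<Rightarrow> complex \<Rightarrow> cmat2" where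
  "disk_matrix a c = vector [vector [a, c], vector [cnj c, cnj a]]"

definition disk_matrices :: "cmat2 set" where
  "disk_matrices = {disk_matrix a c | a c. (cmod a)\<^sup>2 - (cmod c)\<^sup>2 = 1}"

definition disk_group :: "cmat2 set set" where
  "disk_group = to_PSL2C ` disk_matrices"

lemma disk_matrix_nth [simp]:
  "disk_matrix a c $ 1 $ 1 = a" "disk_matrix a c $ 1 $ 2 = c"
  "disk_matrix a c $ 2 $ 1 = cnj c" "disk_matrix a c $ 2 $ 2 = cnj a"
  by (simp_all add: disk_matrix_def)

lemma det_disk_matrix: "det (disk_matrix a c) = of_real ((cmod a)\<^sup>2 - (cmod c)\<^sup>2)"
  by (simp add: det_2 complex_norm_square[symmetric] del: of_real_power)

lemma disk_matrices_subset: "disk_matrices \<subseteq> carrier SL2C"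
  by (auto simp: disk_matrices_def SL2C_def det_disk_matrix simp del: of_real_diff of_real_power)

lemma disk_group_subset: "disk_group \<subseteq> carrier PSL2C"
  using disk_matrices_subset by (auto simp: disk_group_def carrier_PSL2C)

lemma disk_matrix_mult:
  "disk_matrix a c ** disk_matrix b d = disk_matrix (a * b + c * cnj d) (a * d + c * cnj b)"
  by (simp add: vec_eq_iff forall_2 matrix_matrix_mult_def sum_2 algebra_simps)

lemma subgroup_disk_group: "subgroup disk_group PSL2C"
proof -
  interpret P: Group.group PSL2C by (rule group_PSL2C)
  have one: "\<one>\<^bsub>PSL2C\<^esub> = to_PSL2C (disk_matrix 1 0)"
  proof -
    have "disk_matrix 1 0 = mat 1"
      by (simp add: vec_eq_iff forall_2 mat_def)
    then show ?thesis
      by (simp add: PSL2C_def to_PSL2C_eq)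
  qed
  have m1: "disk_matrix 1 0 \<in> disk_matrices"
    unfolding disk_matrices_def by (rule CollectI, rule exI[of _ 1], rule exI[of _ 0]) simp
  have in_disk: "disk_matrix a c \<in> disk_matrices \<longleftrightarrow> det (disk_matrix a c) = 1" for a c
  proof
    assume "det (disk_matrix a c) = 1"
    then have "(cmod a)\<^sup>2 - (cmod c)\<^sup>2 = 1"
      unfolding det_disk_matrix by (metis of_real_eq_1_iff)
    then show "disk_matrix a c \<in> disk_matrices"
      by (auto simp: disk_matrices_def)
  qed (use disk_matrices_subset in \<open>auto simp: SL2C_def\<close>)
  have mult: "X ** Y \<in> disk_matrices" if "X \<in> disk_matrices" "Y \<in> disk_matrices" for X Y
  proof -
    obtain a c b d where XY: "X = disk_matrix a c" "Y = disk_matrix b d"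
      using \<open>X \<in> disk_matrices\<close> \<open>Y \<in> disk_matrices\<close> by (auto simp: disk_matrices_def)
    then have "X ** Y = disk_matrix (a * b + c * cnj d) (a * d + c * cnj b)"
      by (simp add: disk_matrix_mult)
    moreover have "det (X ** Y) = 1"
      using that disk_matrices_subset by (simp add: SL2C_def det_mul subset_iff)
    ultimately show ?thesis
      by (simp add: in_disk)
  qed
  show ?thesis
  proof (rule P.subgroupI)
    show "disk_group \<subseteq> carrier PSL2C" by (rule disk_group_subset)
    show "disk_group \<noteq> {}" using m1 by (auto simp: disk_group_def)
  next
    fix x assume "x \<in> disk_group"
    then obtain a c where x: "x = to_PSL2C (disk_matrix a c)" and m: "disk_matrix a c \<in> disk_matrices"
      by (auto simp: disk_group_def disk_matrices_def)
    then have ac: "a * cnj a - c * cnj c = 1"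
      by (simp add: in_disk det_2)
    then have m': "disk_matrix (cnj a) (- c) \<in> disk_matrices"
      by (simp add: in_disk det_2 mult.commute)
    have "disk_matrix (cnj a) (- c) ** disk_matrix a c = disk_matrix 1 0"
      using ac by (simp add: disk_matrix_mult mult.commute)
    then have "to_PSL2C (disk_matrix (cnj a) (- c)) \<otimes>\<^bsub>PSL2C\<^esub> x = \<one>\<^bsub>PSL2C\<^esub>"
      using m m' disk_matrices_subset by (simp add: x one mult_to_PSL2C subset_iff)
    then have "inv\<^bsub>PSL2C\<^esub> x = to_PSL2C (disk_matrix (cnj a) (- c))"
      using m m' disk_group_subset by (intro P.inv_equality) (auto simp: x disk_group_def)
    then show "inv\<^bsub>PSL2C\<^esub> x \<in> disk_group"
      using m' by (simp add: disk_group_def)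
  next
    fix x y assume "x \<in> disk_group" "y \<in> disk_group"
    then obtain X Y where "x = to_PSL2C X" "X \<in> disk_matrices" "y = to_PSL2C Y" "Y \<in> disk_matrices"
      by (auto simp: disk_group_def)
    then show "x \<otimes>\<^bsub>PSL2C\<^esub> y \<in> disk_group"
      using mult[of X Y] disk_matrices_subset by (auto simp: disk_group_def mult_to_PSL2C subset_iff)
  qed
qed


section \<open>Random elements\<close>

text \<open>Arclength on the unit circle, normalised to total mass 1.\<close>

definition circle_uniform :: "complex measure" where
  "circle_uniform = distr (uniform_measure lborel {0..<2 * pi}) borel cis"

text \<open>
  A random element of the group is given by a random matrix \<open>A\<close> representing it; its first row
  is \<open>(a, c)\<close>. The real variable \<open>|a|\<close> is embedded into the complex numbers
  because \<^const>\<open>prob_space.indep_vars\<close> wants a common value type. The vanishing of \<open>c\<close> is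
  a null event, so that the value \<open>0\<close> of \<open>c / |c|\<close> there is immaterial.
\<close>

definition random_disk_matrix :: "'w measure \<Rightarrow> ('w \<Rightarrow> cmat2) \<Rightarrow> bool" where
  "random_disk_matrix M A \<longleftrightarrow>
     A \<in> borel_measurable M \<and> (\<forall>\<omega>\<in>space M. A \<omega> \<in> disk_matrices) \<and>
     (let a = (\<lambda>\<omega>. A \<omega> $ 1 $ 1); c = (\<lambda>\<omega>. A \<omega> $ 1 $ 2);
          u = (\<lambda>\<omega>. a \<omega> / of_real (cmod (a \<omega>)));
          v = (\<lambda>\<omega>. c \<omega> / of_real (cmod (c \<omega>)))
      in prob_space.indep_vars M (\<lambda>_. borel)
           (\<lambda>i::nat. [u, v, \<lambda>\<omega>. of_real (cmod (a \<omega>))] ! i) {0, 1, 2} \<and>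
         distr M borel u = circle_uniform \<and>
         distr M borel v = circle_uniform \<and>
         distr M borel (\<lambda>\<omega>. 2 * arcsin (1 / cmod (a \<omega>))) = uniform_measure lborel {0..pi})"

end

theory Submission
  imports Defs
begin

text \<open>
  A discrete group contains no elliptic element of infinite order: the powers of such an element
  are rotations about a common fixed point, and by Dirichlet's approximation theorem some of them
  are nontrivial but arbitrarily close to the identity. So if \<open>f\<close> and \<open>g\<close> generate a discrete
  group, then each of them is either not elliptic or elliptic of finite order. An elliptic element
  of finite order has half its trace in a countable set, which is a null event. Since \<open>f\<close> and
  \<open>g\<close> are independent, the bound \<open>1/4\<close> follows once a random element is known to be
  non-elliptic with probability \<open>1/2\<close>.

  An element is non-elliptic if \<open>|Re a| \<ge> 1\<close>. With \<open>u = a / |a|\<close> and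
  \<open>\<phi> = 2 arcsin (1 / |a|)\<close> this means \<open>|Re u| \<ge> sin (\<phi> / 2)\<close>, where \<open>u\<close> and
  \<open>\<phi>\<close> are independent and uniformly distributed on the circle and on \<open>[0, \<pi>]\<close>. The map
  \<open>(u, \<phi>) \<mapsto> (\<i> u, \<pi> - \<phi>)\<close> preserves their joint distribution and turns the inequality into
  \<open>|Im u| \<ge> cos (\<phi> / 2)\<close>, that is, into \<open>|Re u| \<le> sin (\<phi> / 2)\<close>. The two opposite
  inequalities are therefore equally likely, and equality has probability zero
  (\<open>prob_discrete_half_traces\<close>).

  That the group is discrete is a measurable event because the generated group is enumerated by the
  words in the generators, so that discreteness becomes a condition with countable quantifiers on
  continuous functions of the two matrices (\<open>sets_discrete_generate\<close>).
\<close>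

section \<open>Discreteness in terms of representing matrices\<close>

lemma uminus_in_SL2C: "- X \<in> carrier SL2C" if "X \<in> carrier SL2C"
  using that by (simp add: SL2C_def det_2)

lemma to_PSL2C_eq_iff: "to_PSL2C X = to_PSL2C Y \<longleftrightarrow> X = Y \<or> X = - Y"
  by (auto simp: to_PSL2C_eq doubleton_eq_iff)

text \<open>
  The preimage in the matrix group of the image of a ball about \<open>X\<close> is the union of the balls of
  the same radius about \<open>X\<close> and \<open>-X\<close>. Hence the quotient topology is described by distances of
  representing matrices up to sign.
\<close>

lemma discrete_in_PSL2C_iff:
  assumes L: "L \<subseteq> carrier SL2C"
  shows "discrete_in_PSL2C (to_PSL2C ` L) \<longleftrightarrow>
    (\<forall>X\<in>L. \<exists>e>0. \<forall>Y\<in>L. dist Y X < e \<or> dist (- Y) X < e \<longrightarrow> Y = X \<or> Y = - X)"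
    (is "_ \<longleftrightarrow> (\<forall>X\<in>L. \<exists>e>0. ?isolated X e)")
proof -
  have sub: "to_PSL2C ` L \<subseteq> topspace PSL2C_topology"
    using L by (auto simp: topspace_PSL2C_topology carrier_PSL2C)
  have "(\<exists>T. to_PSL2C X \<in> T \<and> openin PSL2C_topology T \<and>
      (\<forall>y\<in>to_PSL2C ` L. y \<in> T \<longrightarrow> y = to_PSL2C X)) \<longleftrightarrow> (\<exists>e>0. ?isolated X e)"
    (is "?nbhd \<longleftrightarrow> _") if X: "X \<in> L" for X
  proof
    assume ?nbhd
    then obtain T where T: "to_PSL2C X \<in> T" "openin PSL2C_topology T"
      "\<And>Y. Y \<in> L \<Longrightarrow> to_PSL2C Y \<in> T \<Longrightarrow> to_PSL2C Y = to_PSL2C X"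
      by auto
    then obtain V where V: "open V" "{A \<in> carrier SL2C. to_PSL2C A \<in> T} = carrier SL2C \<inter> V"
      by (auto simp: openin_PSL2C_topology openin_open)
    have "X \<in> V" using V(2) T(1) X L by blast
    then obtain e where e: "e > 0" "ball X e \<subseteq> V"
      using V(1) open_contains_ball by blast
    have "?isolated X e"
    proof (intro ballI impI)
      fix Y assume Y: "Y \<in> L" and d: "dist Y X < e \<or> dist (- Y) X < e"
      have "to_PSL2C Y \<in> T"
        using d
      proof
        assume "dist Y X < e"
        then have "Y \<in> carrier SL2C \<inter> V" using e(2) Y L by (auto simp: dist_commute)
        then show ?thesis using V(2) by blast
      next
        assume "dist (- Y) X < e"
        then have "- Y \<in> carrier SL2C \<inter> V"
          using e(2) Y L uminus_in_SL2C by (auto simp: dist_commute)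
        then have "to_PSL2C (- Y) \<in> T" using V(2) by blast
        then show ?thesis using to_PSL2C_eq_iff[of "- Y" Y] by simp
      qed
      then show "Y = X \<or> Y = - X"
        using T(3) Y by (simp add: to_PSL2C_eq_iff)
    qed
    with e(1) show "\<exists>e>0. ?isolated X e" by blast
  next
    assume "\<exists>e>0. ?isolated X e"
    then obtain e where e: "e > 0" "?isolated X e" by blast
    define T where "T = to_PSL2C ` (carrier SL2C \<inter> ball X e)"
    have "{A \<in> carrier SL2C. to_PSL2C A \<in> T} = carrier SL2C \<inter> (ball X e \<union> ball (- X) e)"
    proof (rule equalityI; rule subsetI)
      fix A assume "A \<in> {A \<in> carrier SL2C. to_PSL2C A \<in> T}"
      then show "A \<in> carrier SL2C \<inter> (ball X e \<union> ball (- X) e)"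
        by (auto simp: T_def to_PSL2C_eq_iff dist_minus)
    next
      fix A assume A: "A \<in> carrier SL2C \<inter> (ball X e \<union> ball (- X) e)"
      then have "A \<in> ball X e \<or> - A \<in> ball X e"
        using dist_minus[of X "- A"] by auto
      then have "to_PSL2C A \<in> T \<or> to_PSL2C (- A) \<in> T"
        using A uminus_in_SL2C[of A] by (auto simp: T_def)
      then show "A \<in> {A \<in> carrier SL2C. to_PSL2C A \<in> T}"
        using A to_PSL2C_eq_iff[of "- A" A] by simp
    qed
    then have "openin (top_of_set (carrier SL2C)) {A \<in> carrier SL2C. to_PSL2C A \<in> T}"
      by (simp only:) (intro openin_open_Int open_Un open_ball)
    moreover have "T \<subseteq> carrier PSL2C" by (auto simp: T_def carrier_PSL2C)
    ultimately have "openin PSL2C_topology T"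
      unfolding openin_PSL2C_topology by blast
    moreover have "to_PSL2C X \<in> T" using X L e(1) by (auto simp: T_def)
    moreover have "to_PSL2C Y = to_PSL2C X" if "Y \<in> L" "to_PSL2C Y \<in> T" for Y
    proof -
      have "dist Y X < e \<or> dist (- Y) X < e"
        using that(2) by (auto simp: T_def to_PSL2C_eq_iff dist_commute)
      with bspec[OF e(2) that(1)] show ?thesis unfolding to_PSL2C_eq_iff by (rule mp)
    qed
    ultimately show ?nbhd by blast
  qed
  moreover have "to_PSL2C X \<notin> PSL2C_topology derived_set_of (to_PSL2C ` L) \<longleftrightarrow>
    (\<exists>T. to_PSL2C X \<in> T \<and> openin PSL2C_topology T \<and>
      (\<forall>y\<in>to_PSL2C ` L. y \<in> T \<longrightarrow> y = to_PSL2C X))" if "X \<in> L" for X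
    using sub that unfolding in_derived_set_of by blast
  moreover have "discrete_in_PSL2C (to_PSL2C ` L) \<longleftrightarrow>
    (\<forall>X\<in>L. to_PSL2C X \<notin> PSL2C_topology derived_set_of (to_PSL2C ` L))"
    using sub by (simp only: discrete_in_PSL2C_def subtopology_eq_discrete_topology_eq
        disjoint_iff) blast
  ultimately show ?thesis by simp
qed


section \<open>Measurability of the discreteness event\<close>

definition adjugate :: "cmat2 \<Rightarrow> cmat2" where
  "adjugate X = vector [vector [X $ 2 $ 2, - X $ 1 $ 2], vector [- X $ 2 $ 1, X $ 1 $ 1]]"

lemma adjugate_mult: "adjugate X ** X = mat (det X)"
  by (simp add: adjugate_def vec_eq_iff forall_2 matrix_matrix_mult_def sum_2 det_2 mat_def
      algebra_simps)

lemma det_adjugate: "det (adjugate X) = det X"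
  by (simp add: adjugate_def det_2 mult.commute)

lemma adjugate_in_SL2C: "adjugate X \<in> carrier SL2C" if "X \<in> carrier SL2C"
  using that by (simp add: SL2C_def det_adjugate)

lemma mult_in_SL2C: "X ** Y \<in> carrier SL2C" if "X \<in> carrier SL2C" "Y \<in> carrier SL2C"
  using that by (simp add: SL2C_def det_mul)

lemma one_PSL2C: "\<one>\<^bsub>PSL2C\<^esub> = to_PSL2C (mat 1)"
  by (simp add: PSL2C_def to_PSL2C_eq)

lemma one_in_SL2C: "mat 1 \<in> carrier SL2C"
  by (simp add: SL2C_def)

lemma inv_to_PSL2C:
  assumes "X \<in> carrier SL2C"
  shows "inv\<^bsub>PSL2C\<^esub> (to_PSL2C X) = to_PSL2C (adjugate X)"
proof (rule group.inv_equality[OF group_PSL2C])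
  show "to_PSL2C (adjugate X) \<otimes>\<^bsub>PSL2C\<^esub> to_PSL2C X = \<one>\<^bsub>PSL2C\<^esub>"
    using assms by (simp add: mult_to_PSL2C adjugate_in_SL2C adjugate_mult one_PSL2C)
      (simp add: SL2C_def)
qed (use assms adjugate_in_SL2C in \<open>auto simp: carrier_PSL2C\<close>)

text \<open>
  A word in two generators is a list of pairs of truth values: the first component of a letter
  chooses the generator, the second one whether it is inverted. Words form a countable type, over
  which measurable events may be quantified.
\<close>

definition letter_value :: "cmat2 \<Rightarrow> cmat2 \<Rightarrow> bool \<times> bool \<Rightarrow> cmat2" where
  "letter_value A B l = (let X = if fst l then A else B in if snd l then adjugate X else X)"

primrec word_value :: "cmat2 \<Rightarrow> cmat2 \<Rightarrow> (bool \<times> bool) list \<Rightarrow> cmat2" where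
  "word_value A B [] = mat 1"
| "word_value A B (l # w) = letter_value A B l ** word_value A B w"

lemma word_value_append: "word_value A B (v @ w) = word_value A B v ** word_value A B w"
  by (induction v) (simp_all add: matrix_mul_assoc)

lemma letter_value_in_SL2C:
  "letter_value A B l \<in> carrier SL2C" if "A \<in> carrier SL2C" "B \<in> carrier SL2C"
  using that by (simp add: letter_value_def Let_def adjugate_in_SL2C)

lemma word_value_in_SL2C:
  "word_value A B w \<in> carrier SL2C" if "A \<in> carrier SL2C" "B \<in> carrier SL2C"
  using that by (induction w) (simp_all add: one_in_SL2C mult_in_SL2C letter_value_in_SL2C)

lemma generate_eq_words:
  assumes AB: "A \<in> carrier SL2C" "B \<in> carrier SL2C"
  shows "generate PSL2C {to_PSL2C A, to_PSL2C B} = to_PSL2C ` range (word_value A B)"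
proof
  show "generate PSL2C {to_PSL2C A, to_PSL2C B} \<subseteq> to_PSL2C ` range (word_value A B)"
  proof
    fix x assume "x \<in> generate PSL2C {to_PSL2C A, to_PSL2C B}"
    then have "\<exists>w. x = to_PSL2C (word_value A B w)"
    proof induction
      case one
      show ?case by (rule exI[of _ "[]"]) (simp add: one_PSL2C)
    next
      case (incl h)
      then have "h = to_PSL2C (word_value A B [(True, False)]) \<or>
          h = to_PSL2C (word_value A B [(False, False)])"
        by (simp add: letter_value_def)
      then show ?case by blast
    next
      case (inv h)
      then have "inv\<^bsub>PSL2C\<^esub> h = to_PSL2C (word_value A B [(True, True)]) \<or>
          inv\<^bsub>PSL2C\<^esub> h = to_PSL2C (word_value A B [(False, True)])"
        using AB by (auto simp: letter_value_def inv_to_PSL2C)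
      then show ?case by blast
    next
      case (eng h1 h2)
      then obtain v w where "h1 = to_PSL2C (word_value A B v)" "h2 = to_PSL2C (word_value A B w)"
        by blast
      then show ?case
        using AB
        by (intro exI[of _ "v @ w"]) (simp add: mult_to_PSL2C word_value_in_SL2C word_value_append)
    qed
    then show "x \<in> to_PSL2C ` range (word_value A B)" by blast
  qed
next
  have "to_PSL2C (letter_value A B l) \<in> generate PSL2C {to_PSL2C A, to_PSL2C B}" for l
    using AB by (auto simp: letter_value_def Let_def inv_to_PSL2C[symmetric]
        intro: generate.incl generate.inv)
  then have "to_PSL2C (word_value A B w) \<in> generate PSL2C {to_PSL2C A, to_PSL2C B}" for w
  proof (induction w)
    case Nil
    then show ?case using generate.one[of PSL2C] by (simp add: one_PSL2C)
  next
    case (Cons l w)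
    then show ?case
      using generate.eng[of "to_PSL2C (letter_value A B l)" PSL2C _ "to_PSL2C (word_value A B w)"] AB
      by (simp add: mult_to_PSL2C letter_value_in_SL2C word_value_in_SL2C)
  qed
  then show "to_PSL2C ` range (word_value A B) \<subseteq> generate PSL2C {to_PSL2C A, to_PSL2C B}"
    by blast
qed

text \<open>
  Entrywise continuity suits functions whose values are given as explicit two-by-two arrays.
\<close>

lemma continuous_on_cmat2I:
  fixes f :: "'a :: topological_space \<Rightarrow> cmat2"
  assumes "continuous_on S (\<lambda>x. f x $ 1 $ 1)" "continuous_on S (\<lambda>x. f x $ 1 $ 2)"
    "continuous_on S (\<lambda>x. f x $ 2 $ 1)" "continuous_on S (\<lambda>x. f x $ 2 $ 2)"
  shows "continuous_on S f"
proof -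
  have "\<forall>i j. continuous_on S (\<lambda>x. f x $ i $ j)"
    using assms by (simp add: forall_2)
  then have "continuous_on S (\<lambda>x. \<chi> i j. f x $ i $ j)"
    by (intro continuous_on_vec_lambda) blast
  then show ?thesis by simp
qed

lemma borel_measurable_matrix_mult:
  assumes "X \<in> borel_measurable M" "Y \<in> borel_measurable M"
  shows "(\<lambda>\<omega>. X \<omega> ** Y \<omega> :: cmat2) \<in> borel_measurable M"
proof (rule borel_measurable_continuous_Pair[OF assms])
  show "continuous_on UNIV (\<lambda>x. fst x ** snd x :: cmat2)"
    unfolding matrix_matrix_mult_def by (intro continuous_intros continuous_on_vec_lambda)
qed

lemma borel_measurable_adjugate: "adjugate \<in> borel_measurable borel"
  by (intro borel_measurable_continuous_onI continuous_on_cmat2I)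
    (simp_all add: adjugate_def continuous_intros)

lemma borel_measurable_word_value:
  assumes "A \<in> borel_measurable M" "B \<in> borel_measurable M"
  shows "(\<lambda>\<omega>. word_value (A \<omega>) (B \<omega>) w) \<in> borel_measurable M"
proof (induction w)
  case (Cons l w)
  have "(\<lambda>\<omega>. letter_value (A \<omega>) (B \<omega>) l) \<in> borel_measurable M"
    using assms measurable_compose[OF _ borel_measurable_adjugate]
    by (cases "fst l"; cases "snd l") (auto simp: letter_value_def)
  then show ?case
    using Cons.IH by (simp add: borel_measurable_matrix_mult)
qed simp

text \<open>
  Discreteness is tested at every element of the group, with a radius \<open>1 / (n + 1)\<close>, against every
  other element. Running through words instead of group elements leaves countably many
  conditions, each of which is Borel in the pair of matrices.
\<close>

lemma sets_discrete_generate: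
  fixes A B :: "'w \<Rightarrow> cmat2"
  assumes [measurable]: "A \<in> borel_measurable M" "B \<in> borel_measurable M"
    and AB: "\<And>\<omega>. \<omega> \<in> space M \<Longrightarrow> A \<omega> \<in> carrier SL2C \<and> B \<omega> \<in> carrier SL2C"
  shows "{\<omega> \<in> space M. discrete_in_PSL2C (generate PSL2C {to_PSL2C (A \<omega>), to_PSL2C (B \<omega>)})}
    \<in> sets M"
proof -
  let ?W = "\<lambda>\<omega>. word_value (A \<omega>) (B \<omega>)"
  have [measurable]: "(\<lambda>\<omega>. ?W \<omega> w) \<in> borel_measurable M" for w
    by (rule borel_measurable_word_value) fact+
  have "discrete_in_PSL2C (generate PSL2C {to_PSL2C (A \<omega>), to_PSL2C (B \<omega>)}) \<longleftrightarrow>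
      (\<forall>v. \<exists>n. \<forall>w. dist (?W \<omega> w) (?W \<omega> v) < inverse (real (Suc n)) \<or>
          dist (- ?W \<omega> w) (?W \<omega> v) < inverse (real (Suc n)) \<longrightarrow>
        ?W \<omega> w = ?W \<omega> v \<or> ?W \<omega> w = - ?W \<omega> v)" if "\<omega> \<in> space M" for \<omega>
  proof -
    let ?R = "\<lambda>v e. \<forall>w. dist (?W \<omega> w) (?W \<omega> v) < e \<or> dist (- ?W \<omega> w) (?W \<omega> v) < e \<longrightarrow>
        ?W \<omega> w = ?W \<omega> v \<or> ?W \<omega> w = - ?W \<omega> v"
    have "(\<exists>e>0. ?R v e) \<longleftrightarrow> (\<exists>n. ?R v (inverse (real (Suc n))))" for v
    proof
      assume "\<exists>e>0. ?R v e"
      then obtain e where e: "e > 0" "?R v e" by blast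
      obtain n where "inverse (real (Suc n)) < e" using reals_Archimedean[OF e(1)] by blast
      then have "?R v (inverse (real (Suc n)))" using e(2) by (meson less_trans)
      then show "\<exists>n. ?R v (inverse (real (Suc n)))" by blast
    next
      assume "\<exists>n. ?R v (inverse (real (Suc n)))"
      then obtain n where "?R v (inverse (real (Suc n)))" by blast
      moreover have "inverse (real (Suc n)) > 0" by simp
      ultimately show "\<exists>e>0. ?R v e" by blast
    qed
    moreover have "range (?W \<omega>) \<subseteq> carrier SL2C"
      using AB[OF that] word_value_in_SL2C by blast
    ultimately show ?thesis
      using AB[OF that] by (simp add: generate_eq_words discrete_in_PSL2C_iff del: of_nat_Suc)
  qed
  then have "{\<omega> \<in> space M. discrete_in_PSL2C (generate PSL2C {to_PSL2C (A \<omega>), to_PSL2C (B \<omega>)})} =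
      {\<omega> \<in> space M. \<forall>v. \<exists>n. \<forall>w. dist (?W \<omega> w) (?W \<omega> v) < inverse (real (Suc n)) \<or>
          dist (- ?W \<omega> w) (?W \<omega> v) < inverse (real (Suc n)) \<longrightarrow>
        ?W \<omega> w = ?W \<omega> v \<or> ?W \<omega> w = - ?W \<omega> v}"
    by blast
  also have "\<dots> \<in> sets M" by measurable
  finally show ?thesis .
qed


section \<open>Elliptic elements of infinite order\<close>

text \<open>
  For \<^term>\<open>b\<^sup>2 - (cmod d)\<^sup>2 = 1\<close> the matrix with rows \<open>(\<i> b, d)\<close> and \<open>(cnj d, - \<i> b)\<close>
  has square \<open>- 1\<close>, and this is its exponential at time \<open>t\<close>: the rotations of the disk about a
  fixed point, parametrized by half of the rotation angle.
\<close>

definition elliptic_flow :: "real \<Rightarrow> complex \<Rightarrow> real \<Rightarrow> cmat2" where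
  "elliptic_flow b d t = disk_matrix (Complex (cos t) (b * sin t)) (of_real (sin t) * d)"

lemma elliptic_flow_add:
  assumes "b\<^sup>2 - (cmod d)\<^sup>2 = 1"
  shows "elliptic_flow b d s ** elliptic_flow b d t = elliptic_flow b d (s + t)"
proof -
  have "d * cnj d = of_real (b\<^sup>2 - 1)"
    using assms complex_norm_square[of d] by (metis add_diff_cancel_left' add_diff_eq diff_add_cancel)
  then have "of_real (sin s) * d * cnj (of_real (sin t) * d) = of_real (sin s * sin t * (b\<^sup>2 - 1))"
    by (simp add: mult_ac)
  moreover have "Complex (cos s) (b * sin s) * Complex (cos t) (b * sin t)
      + of_real (sin s * sin t * (b\<^sup>2 - 1)) = Complex (cos (s + t)) (b * sin (s + t))"
    by (simp add: complex_eq_iff cos_add sin_add power2_eq_square algebra_simps)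
  moreover have "Complex (cos s) (b * sin s) * (of_real (sin t) * d)
      + of_real (sin s) * d * cnj (Complex (cos t) (b * sin t)) = of_real (sin (s + t)) * d"
    by (simp add: complex_eq_iff sin_add algebra_simps)
  ultimately show ?thesis
    by (simp only: elliptic_flow_def disk_matrix_mult)
qed

lemma elliptic_flow_0: "elliptic_flow b d 0 = mat 1"
  by (simp add: elliptic_flow_def vec_eq_iff forall_2 mat_def complex_eq_iff)

lemma elliptic_flow_add_pi: "elliptic_flow b d (t + pi) = - elliptic_flow b d t"
  by (simp add: elliptic_flow_def vec_eq_iff forall_2 complex_eq_iff)

lemma to_PSL2C_elliptic_flow_add_int_pi:
  "to_PSL2C (elliptic_flow b d (t + of_int h * pi)) = to_PSL2C (elliptic_flow b d t)"
proof (induction h rule: int_induct[of _ 0])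
  case base
  show ?case by simp
next
  case (step1 h)
  have "elliptic_flow b d (t + of_int (h + 1) * pi) = - elliptic_flow b d (t + of_int h * pi)"
    by (simp add: elliptic_flow_add_pi[symmetric] algebra_simps)
  then show ?case
    using step1 by (simp add: to_PSL2C_eq insert_commute)
next
  case (step2 h)
  have "elliptic_flow b d (t + of_int h * pi) = - elliptic_flow b d (t + of_int (h - 1) * pi)"
    by (simp add: elliptic_flow_add_pi[symmetric] algebra_simps)
  then show ?case
    using step2 by (simp add: to_PSL2C_eq insert_commute)
qed

lemma elliptic_flow_nontrivial:
  assumes "sin t \<noteq> 0" "b\<^sup>2 - (cmod d)\<^sup>2 = 1"
  shows "elliptic_flow b d t \<noteq> mat 1" "elliptic_flow b d t \<noteq> - mat 1"
proof -
  have "b \<noteq> 0" using assms(2) by (smt (verit) zero_le_power2 power_zero_numeral)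
  then have "Im (elliptic_flow b d t $ 1 $ 1) \<noteq> 0"
    using assms(1) by (simp add: elliptic_flow_def)
  then show "elliptic_flow b d t \<noteq> mat 1" "elliptic_flow b d t \<noteq> - mat 1"
    by (auto simp: mat_def)
qed

lemma isCont_elliptic_flow: "isCont (elliptic_flow b d) t"
proof -
  have "continuous_on UNIV (elliptic_flow b d)"
    by (rule continuous_on_cmat2I)
      (auto simp: elliptic_flow_def Complex_eq intro!: continuous_intros)
  then show ?thesis by (simp add: continuous_on_eq_continuous_at)
qed

text \<open>
  If \<open>t / \<pi>\<close> is irrational, then some multiple \<open>k t\<close> with \<open>k > 0\<close> comes arbitrarily close to an
  integral multiple of \<open>\<pi>\<close> without being one. Up to sign, the \<open>k\<close>-th power is then close to the
  identity matrix but different from it.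
\<close>

lemma elliptic_infinite_order_not_discrete:
  assumes G: "subgroup G PSL2C" and t: "t / pi \<notin> \<rat>" and bd: "b\<^sup>2 - (cmod d)\<^sup>2 = 1"
    and "to_PSL2C (elliptic_flow b d t) \<in> G"
  shows "\<not> discrete_in_PSL2C G"
proof
  let ?F = "elliptic_flow b d"
  have F: "?F s \<in> carrier SL2C" for s
  proof -
    have "(cmod (Complex (cos s) (b * sin s)))\<^sup>2 - (cmod (of_real (sin s) * d))\<^sup>2
        = (cos s)\<^sup>2 + (sin s)\<^sup>2 * (b\<^sup>2 - (cmod d)\<^sup>2)"
      by (simp add: cmod_power2[of "Complex _ _"] norm_mult power_mult_distrib algebra_simps)
    then show ?thesis
      by (simp add: SL2C_def elliptic_flow_def det_disk_matrix bd del: of_real_diff of_real_power)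
  qed
  have powers: "to_PSL2C (?F (of_nat k * t)) \<in> G" for k
  proof (induction k)
    case 0
    show ?case using subgroup.one_closed[OF G] by (simp add: elliptic_flow_0 one_PSL2C)
  next
    case (Suc k)
    have "to_PSL2C (?F t) \<otimes>\<^bsub>PSL2C\<^esub> to_PSL2C (?F (of_nat k * t)) \<in> G"
      using subgroup.m_closed[OF G] Suc assms(4) by blast
    then show ?case by (simp add: mult_to_PSL2C F elliptic_flow_add[OF bd] algebra_simps)
  qed
  assume "discrete_in_PSL2C G"
  define L where "L = {X \<in> carrier SL2C. to_PSL2C X \<in> G}"
  have "to_PSL2C ` L = G"
    using subgroup.subset[OF G] by (auto simp: L_def carrier_PSL2C)
  moreover have one: "mat 1 \<in> L"
    using subgroup.one_closed[OF G] by (simp add: L_def one_in_SL2C one_PSL2C)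
  ultimately obtain e where e: "e > 0"
      "\<And>Y. Y \<in> L \<Longrightarrow> dist Y (mat 1) < e \<Longrightarrow> Y = mat 1 \<or> Y = - mat 1"
    using discrete_in_PSL2C_iff[of L] \<open>discrete_in_PSL2C G\<close> by (auto simp: L_def)
  obtain r where r: "r > 0" "\<And>s. \<bar>s\<bar> < r \<Longrightarrow> dist (?F s) (mat 1) < e"
  proof -
    have "\<forall>e>0. \<exists>r>0. \<forall>s. dist s 0 < r \<longrightarrow> dist (?F s) (?F 0) < e"
      using isCont_elliptic_flow[of 0 b d] by (simp add: continuous_at_eps_delta dist_norm)
    then show thesis using e(1) that by (auto simp: elliptic_flow_0)
  qed
  obtain N where N: "inverse (real (Suc N)) < r / pi"
    using reals_Archimedean[of "r / pi"] r(1) by auto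
  obtain h k where hk: "0 < k" "\<bar>of_int k * (t / pi) - of_int h\<bar> < 1 / real (Suc N)"
    using Dirichlet_approx[of "Suc N" "t / pi"] by (metis zero_less_Suc)
  define s where "s = of_int k * t - of_int h * pi"
  have s: "s = pi * (of_int k * (t / pi) - of_int h)"
    by (simp add: s_def field_simps)
  have "\<bar>s\<bar> < r"
  proof -
    have "\<bar>of_int k * (t / pi) - of_int h\<bar> < r / pi"
      using hk(2) N[unfolded inverse_eq_divide] by (rule less_trans)
    then show ?thesis
      by (simp add: s abs_mult pos_less_divide_eq mult.commute)
  qed
  have "sin s \<noteq> 0"
  proof
    assume "sin s = 0"
    then obtain j :: int where "s = of_int j * pi"
      by (auto simp: sin_zero_iff_int2)
    then have "t / pi = of_int (j + h) / of_int k"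
      using hk(1) by (simp add: s_def field_simps)
    then show False using t by (metis Rats_divide Rats_of_int)
  qed
  have "to_PSL2C (?F s) = to_PSL2C (?F (of_nat (nat k) * t))"
    using to_PSL2C_elliptic_flow_add_int_pi[of b d s h] hk(1) by (simp add: s_def)
  then have "?F s \<in> L"
    using powers[of "nat k"] F by (simp add: L_def)
  then show False
    using e(2) r(2)[OF \<open>\<bar>s\<bar> < r\<close>] elliptic_flow_nontrivial[OF \<open>sin s \<noteq> 0\<close> bd] by blast
qed

text \<open>
  The half traces of the elements that can occur in a discrete group: \<open>|x| \<ge> 1\<close> for the
  non-elliptic ones, and for the elliptic ones those that belong to finite order.
\<close>

definition discrete_half_traces :: "real set" where
  "discrete_half_traces = {x. \<bar>x\<bar> < 1 \<longrightarrow> arccos x / pi \<in> \<rat>}"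

lemma half_trace_if_discrete:
  assumes G: "subgroup G PSL2C" "discrete_in_PSL2C G"
    and X: "X \<in> disk_matrices" "to_PSL2C X \<in> G"
  shows "Re (X $ 1 $ 1) \<in> discrete_half_traces"
proof (rule ccontr)
  obtain a c where ac: "X = disk_matrix a c" "(cmod a)\<^sup>2 - (cmod c)\<^sup>2 = 1"
    using X(1) by (auto simp: disk_matrices_def)
  assume "Re (X $ 1 $ 1) \<notin> discrete_half_traces"
  then have a: "\<bar>Re a\<bar> < 1" "arccos (Re a) / pi \<notin> \<rat>"
    by (auto simp: discrete_half_traces_def ac(1))
  \<comment> \<open>An elliptic matrix is determined by its half trace \<open>cos t\<close> and its place \<open>(b, d)\<close> in the flow.\<close>
  define t b d where "t = arccos (Re a)" and "b = Im a / sin t" and "d = c / of_real (sin t)"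
  have cos: "cos t = Re a" using a(1) by (simp add: t_def)
  have "(sin t)\<^sup>2 = 1 - (Re a)\<^sup>2" using sin_squared_eq[of t] cos by simp
  moreover have "(Re a)\<^sup>2 < 1" using a(1) by (simp add: abs_square_less_1)
  ultimately have sin: "sin t \<noteq> 0" "(sin t)\<^sup>2 = (Im a)\<^sup>2 - (cmod c)\<^sup>2"
    using ac(2) by (auto simp: cmod_power2)
  have "b\<^sup>2 - (cmod d)\<^sup>2 = ((Im a)\<^sup>2 - (cmod c)\<^sup>2) / (sin t)\<^sup>2"
    by (simp add: b_def d_def norm_divide power_divide diff_divide_distrib)
  then have bd: "b\<^sup>2 - (cmod d)\<^sup>2 = 1" using sin(1) unfolding sin(2)[symmetric] by simp
  have "X = elliptic_flow b d t"
    using sin(1) by (simp add: ac(1) elliptic_flow_def b_def d_def cos)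
  then show False
    using elliptic_infinite_order_not_discrete[OF G(1) _ bd] a(2) G(2) X(2) by (simp add: t_def)
qed


section \<open>The distribution of the trace\<close>

abbreviation half_turn_uniform :: "real measure" where
  "half_turn_uniform \<equiv> uniform_measure lborel {0..pi}"

lemma prob_space_half_turn_uniform: "prob_space half_turn_uniform"
  by (rule prob_space_uniform_measure) (simp_all add: pi_gt_zero less_imp_neq)

lemma measurable_cis [measurable]: "cis \<in> borel_measurable borel"
  by (simp add: borel_measurable_continuous_onI continuous_on_cis)

lemma prob_space_circle_uniform: "prob_space circle_uniform"
  unfolding circle_uniform_def
proof (rule prob_space.prob_space_distr)
  show "prob_space (uniform_measure lborel {0..<2 * pi})"
    by (rule prob_space_uniform_measure) (simp_all add: pi_gt_zero less_imp_neq)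
qed measurable

lemma sets_circle_uniform [simp, measurable_cong]: "sets circle_uniform = sets borel"
  by (simp add: circle_uniform_def)

lemma emeasure_circle_uniform:
  assumes [measurable]: "E \<in> sets borel"
  shows "emeasure circle_uniform E =
    emeasure lborel ({0..<2 * pi} \<inter> cis -` E) / emeasure lborel {0..<2 * pi}"
proof -
  have [measurable]: "cis -` E \<in> sets borel"
    using measurable_sets[OF measurable_cis, of E] by simp
  show ?thesis
    by (simp add: circle_uniform_def emeasure_distr)
qed

lemma emeasure_circle_uniform_Re_eq: "emeasure circle_uniform {u. Re u = x} = 0"
proof -
  have "{0..<2 * pi} \<inter> cis -` {u. Re u = x} \<subseteq> {arccos x, 2 * pi - arccos x}"
  proof
    fix t assume "t \<in> {0..<2 * pi} \<inter> cis -` {u. Re u = x}"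
    then have t: "0 \<le> t" "t < 2 * pi" "x = cos t" by auto
    show "t \<in> {arccos x, 2 * pi - arccos x}"
    proof (cases "t \<le> pi")
      case True
      then show ?thesis using t by (simp add: arccos_cos)
    next
      case False
      have "x = cos (2 * pi - t)" using t(3) by (simp add: cos_diff)
      moreover have "arccos (cos (2 * pi - t)) = 2 * pi - t"
        using False t(2) by (intro arccos_cos) auto
      ultimately have "arccos x = 2 * pi - t" by (simp only:)
      then show ?thesis by simp
    qed
  qed
  then have "countable ({0..<2 * pi} \<inter> cis -` {u. Re u = x})"
    by (meson countable_finite finite.intros finite_subset)
  then have "emeasure lborel ({0..<2 * pi} \<inter> cis -` {u. Re u = x}) = 0"
    by (rule emeasure_lborel_countable)
  moreover have "{u. Re u = x} \<in> sets borel" by measurable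
  ultimately show ?thesis by (simp add: emeasure_circle_uniform)
qed

lemma emeasure_lborel_affine_vimage:
  assumes [measurable]: "E \<in> sets borel" and c: "\<bar>c\<bar> = 1"
  shows "emeasure lborel ((\<lambda>x. t + c * x) -` E) = emeasure lborel (E :: real set)"
proof -
  have "(\<lambda>x. t + c * x) -` E \<inter> space borel \<in> sets borel"
    by (rule measurable_sets) measurable
  then have [measurable]: "(\<lambda>x. t + c * x) -` E \<in> sets borel" by simp
  have "emeasure lborel E = (\<integral>\<^sup>+x. indicator E x \<partial>lborel)" by simp
  also have "\<dots> = \<bar>c\<bar> * (\<integral>\<^sup>+x. indicator E (t + c * x) \<partial>lborel)"
    using c by (intro nn_integral_real_affine) auto
  also have "\<dots> = (\<integral>\<^sup>+x. indicator ((\<lambda>x. t + c * x) -` E) x \<partial>lborel)"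
    using c by (simp add: indicator_def)
  also have "\<dots> = emeasure lborel ((\<lambda>x. t + c * x) -` E)" by simp
  finally show ?thesis by simp
qed

text \<open>
  Turning by a right angle exchanges \<open>|Re u|\<close> and \<open>|Im u|\<close>, which is all that the symmetry
  argument for the trace asks of the circle.
\<close>

lemma circle_uniform_rotate: "distr circle_uniform borel ((*) \<i>) = circle_uniform"
proof (rule measure_eqI)
  fix E assume "E \<in> sets (distr circle_uniform borel ((*) \<i>))"
  then have E [measurable]: "E \<in> sets borel" by simp
  have [measurable]: "cis -` E \<in> sets borel"
    using measurable_sets[OF measurable_cis, of E] by simp
  have [measurable]: "(*) \<i> \<in> borel_measurable borel" by measurable
  have iE: "(*) \<i> -` E \<in> sets borel"
    using measurable_sets[of "(*) \<i>" borel borel E] by simp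
  \<comment> \<open>The turned angle \<open>pi/2 + t\<close> passes \<open>2 * pi\<close> at \<open>t = 3*pi/2\<close>. The sets \<open>S1\<close> and \<open>S2\<close>
      collect its values in \<open>[0, 2 * pi)\<close> that come from \<open>t\<close> before and after this point.\<close>
  define S1 S2 where "S1 = {pi/2..<2*pi} \<inter> cis -` E" and "S2 = {0..<pi/2} \<inter> cis -` E"
  have [measurable]: "S1 \<in> sets borel" "S2 \<in> sets borel" by (simp_all add: S1_def S2_def)
  have i: "\<i> * cis t = cis (pi/2 + t)" for t
    by (simp add: cis_mult[symmetric])
  have per: "cis (pi/2 + t) = cis (- (3*pi/2) + t)" for t
  proof -
    have "cis (pi/2 + t) = cis (- (3*pi/2) + t) * cis (2 * pi)"
      unfolding cis_mult by (rule arg_cong[of _ _ cis]) simp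
    then show ?thesis by simp
  qed
  have split: "{0..<2*pi} \<inter> cis -` ((*) \<i> -` E)
      = (\<lambda>x. pi/2 + 1 * x) -` S1 \<union> (\<lambda>x. - (3*pi/2) + 1 * x) -` S2"
    (is "?L = ?S1 \<union> ?S2")
  proof (rule Set.set_eqI)
    fix t
    show "t \<in> ?L \<longleftrightarrow> t \<in> ?S1 \<union> ?S2"
      using per[of t] by (cases "t < 3*pi/2") (auto simp: i S1_def S2_def)
  qed
  have "(\<lambda>x. pi/2 + 1 * x) -` S1 \<inter> space borel \<in> sets borel"
    "(\<lambda>x. - (3*pi/2) + 1 * x) -` S2 \<inter> space borel \<in> sets borel"
    by (rule measurable_sets; measurable)+
  then have "emeasure lborel ?L = emeasure lborel ?S1 + emeasure lborel ?S2"
    unfolding split by (intro plus_emeasure[symmetric]) (auto simp: S1_def S2_def)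
  also have "\<dots> = emeasure lborel S1 + emeasure lborel S2"
    by (simp only: emeasure_lborel_affine_vimage[OF \<open>S1 \<in> sets borel\<close>]
        emeasure_lborel_affine_vimage[OF \<open>S2 \<in> sets borel\<close>] abs_one)
  also have "\<dots> = emeasure lborel (S1 \<union> S2)"
    by (intro plus_emeasure) (auto simp: S1_def S2_def)
  also have "S1 \<union> S2 = {0..<2*pi} \<inter> cis -` E"
    by (auto simp: S1_def S2_def)
  finally have "emeasure lborel ?L = emeasure lborel ({0..<2*pi} \<inter> cis -` E)" .
  then have "emeasure circle_uniform ((*) \<i> -` E) = emeasure circle_uniform E"
    by (simp add: emeasure_circle_uniform iE)
  then show "emeasure (distr circle_uniform borel ((*) \<i>)) E = emeasure circle_uniform E"
    by (simp add: emeasure_distr sets_eq_imp_space_eq[OF sets_circle_uniform])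
qed simp

lemma half_turn_uniform_reflect:
  "distr half_turn_uniform lborel (\<lambda>s. pi - s) = half_turn_uniform"
proof (rule measure_eqI)
  fix E assume "E \<in> sets (distr half_turn_uniform lborel (\<lambda>s. pi - s))"
  then have E [measurable]: "E \<in> sets borel" by simp
  have "(\<lambda>s. pi - s) -` E \<inter> space borel \<in> sets borel"
    by (rule measurable_sets[OF _ E]) measurable
  then have pre: "(\<lambda>s. pi - s) -` E \<in> sets borel" by simp
  have "{0..pi} \<inter> (\<lambda>s. pi - s) -` E = (\<lambda>s. pi + (- 1) * s) -` ({0..pi} \<inter> E)"
    by auto
  then have "emeasure lborel ({0..pi} \<inter> (\<lambda>s. pi - s) -` E) = emeasure lborel ({0..pi} \<inter> E)"
    using emeasure_lborel_affine_vimage[of "{0..pi} \<inter> E" "- 1" pi] by simp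
  then show "emeasure (distr half_turn_uniform lborel (\<lambda>s. pi - s)) E = emeasure half_turn_uniform E"
    using pre by (simp add: emeasure_distr)
qed simp

text \<open>
  The joint distribution of \<open>a / |a|\<close> and \<open>2 * arcsin (1 / |a|)\<close> for a random matrix.
\<close>

abbreviation polar_distribution :: "(complex \<times> real) measure" where
  "polar_distribution \<equiv> circle_uniform \<Otimes>\<^sub>M half_turn_uniform"

text \<open>
  On pairs that come from a matrix, this symmetry exchanges the conditions \<open>|Re a| \<ge> 1\<close> and
  \<open>|Re a| \<le> 1\<close>, because \<open>sin ((\<pi> - \<phi>) / 2) = cos (\<phi> / 2)\<close> and the squares of \<open>Re u\<close> and
  \<open>Im u\<close> add up to one.
\<close>

lemma polar_distribution_symmetric:
  "distr polar_distribution (borel \<Otimes>\<^sub>M lborel) (\<lambda>(u, s). (\<i> * u, pi - s)) = polar_distribution"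
proof -
  interpret prob_space half_turn_uniform by (rule prob_space_half_turn_uniform)
  have "distr circle_uniform borel ((*) \<i>) \<Otimes>\<^sub>M distr half_turn_uniform lborel (\<lambda>s. pi - s)
      = distr polar_distribution (borel \<Otimes>\<^sub>M lborel) (\<lambda>(u, s). (\<i> * u, pi - s))"
  proof (rule pair_measure_distr)
    show "(*) \<i> \<in> measurable circle_uniform borel" by measurable
    show "sigma_finite_measure (distr half_turn_uniform lborel (\<lambda>s. pi - s))"
      unfolding half_turn_uniform_reflect by unfold_locales
  qed measurable
  then show ?thesis
    by (simp add: circle_uniform_rotate half_turn_uniform_reflect)
qed

text \<open>
  With \<open>sin (\<phi> / 2) = 1 / |a|\<close> the equation says that \<open>Re a = x\<close>. For each fixed \<open>\<phi>\<close> it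
  fixes \<open>Re u\<close> and so leaves at most two points of the circle.
\<close>

lemma polar_distribution_null:
  "emeasure polar_distribution {p. Re (fst p) = x * sin (snd p / 2)} = 0"
proof -
  interpret C: prob_space circle_uniform by (rule prob_space_circle_uniform)
  interpret H: prob_space half_turn_uniform by (rule prob_space_half_turn_uniform)
  interpret pair_sigma_finite circle_uniform half_turn_uniform ..
  have "{p. Re (fst p) = x * sin (snd p / 2)} \<in> sets (borel :: (complex \<times> real) measure)"
    by (intro borel_closed closed_Collect_eq continuous_intros) simp
  also have "sets borel = sets polar_distribution"
    unfolding borel_prod[symmetric] by (intro sets_pair_measure_cong) simp_all
  finally show ?thesis
    by (subst emeasure_pair_measure_alt2) (simp_all add: emeasure_circle_uniform_Re_eq vimage_def)
qed

lemma discrete_half_traces_cases: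
  obtains C where "countable C" "1 \<in> C" "- 1 \<in> C" "discrete_half_traces = {x. 1 \<le> \<bar>x\<bar>} \<union> C"
proof
  define C where "C = {x. \<bar>x\<bar> < 1 \<and> arccos x / pi \<in> \<rat>} \<union> {- 1, 1}"
  have "{x. \<bar>x\<bar> < 1 \<and> arccos x / pi \<in> \<rat>} \<subseteq> (\<lambda>q. cos (q * pi)) ` \<rat>"
  proof
    fix x assume "x \<in> {x. \<bar>x\<bar> < 1 \<and> arccos x / pi \<in> \<rat>}"
    then have "arccos x / pi \<in> \<rat>" "x = cos (arccos x / pi * pi)"
      by (auto simp: cos_arccos_abs)
    then show "x \<in> (\<lambda>q. cos (q * pi)) ` \<rat>" by blast
  qed
  then show "countable C"
    unfolding C_def by (meson countable_rat countable_Un countable_finite countable_image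
        countable_subset finite.intros)
  show "1 \<in> C" "- 1 \<in> C" by (simp_all add: C_def)
  show "discrete_half_traces = {x. 1 \<le> \<bar>x\<bar>} \<union> C"
    by (auto simp: discrete_half_traces_def C_def)
qed

lemma sets_discrete_half_traces [measurable]: "discrete_half_traces \<in> sets borel"
proof -
  obtain C where C: "countable C" "discrete_half_traces = {x. 1 \<le> \<bar>x\<bar>} \<union> C"
    by (rule discrete_half_traces_cases)
  have "C \<in> sets borel"
    by (rule sets.countable[OF _ C(1)]) simp
  moreover have "{x :: real. 1 \<le> \<bar>x\<bar>} \<in> sets borel" by measurable
  ultimately show ?thesis unfolding C(2) by (rule sets.Un[rotated])
qed

text \<open>
  The function \<^const>\<open>arcsin\<close> is continuous on the interval from \<open>-1\<close> to \<open>1\<close>, and its values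
  elsewhere carry no meaning. Clamping the argument makes it continuous on the whole line.
\<close>

lemma borel_measurable_clamped_arcsin:
  "(\<lambda>x. arcsin (max (- 1) (min 1 x))) \<in> borel_measurable borel"
  by (intro borel_measurable_continuous_onI continuous_on_arcsin continuous_intros) auto

text \<open>
  Half of the probability comes from the non-elliptic elements, by the symmetry of
  \<^term>\<open>polar_distribution\<close>. The elliptic elements of finite order contribute nothing, because
  every single value of the half trace is a null event.
\<close>

lemma prob_discrete_half_traces:
  assumes "prob_space M" and rand: "random_disk_matrix M A"
  shows "measure M {\<omega> \<in> space M. Re (A \<omega> $ 1 $ 1) \<in> discrete_half_traces} = 1 / 2"
proof -
  interpret prob_space M by fact
  define a u \<phi> where "a = (\<lambda>\<omega>. A \<omega> $ 1 $ 1)" and "u = (\<lambda>\<omega>. a \<omega> / of_real (cmod (a \<omega>)))"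
    and "\<phi> = (\<lambda>\<omega>. 2 * arcsin (max (- 1) (min 1 (1 / cmod (a \<omega>)))))"
  have mod_a: "1 \<le> cmod (a \<omega>)" if "\<omega> \<in> space M" for \<omega>
  proof -
    have "A \<omega> \<in> disk_matrices" using rand that by (simp add: random_disk_matrix_def)
    then obtain b d where "A \<omega> = disk_matrix b d" "(cmod b)\<^sup>2 - (cmod d)\<^sup>2 = 1"
      by (auto simp: disk_matrices_def)
    then have "a \<omega> = b" "(cmod b)\<^sup>2 = 1 + (cmod d)\<^sup>2" by (simp_all add: a_def)
    then have "1\<^sup>2 \<le> (cmod (a \<omega>))\<^sup>2" by simp
    then show ?thesis by (rule power2_le_imp_le) simp
  qed
  have inverse_a: "- 1 \<le> 1 / cmod (a \<omega>)" "1 / cmod (a \<omega>) \<le> 1" if "\<omega> \<in> space M" for \<omega>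
  proof -
    have "0 < cmod (a \<omega>)" using mod_a[OF that] by linarith
    then show "- 1 \<le> 1 / cmod (a \<omega>)" "1 / cmod (a \<omega>) \<le> 1"
      using mod_a[OF that] by (simp_all add: pos_le_divide_eq pos_divide_le_eq)
  qed
  then have \<phi>_eq: "\<phi> \<omega> = 2 * arcsin (1 / cmod (a \<omega>))" if "\<omega> \<in> space M" for \<omega>
    using that by (simp only: \<phi>_def min.absorb2 max.absorb2)
  have A [measurable]: "A \<in> borel_measurable M" using rand by (simp add: random_disk_matrix_def)
  have a [measurable]: "a \<in> borel_measurable M"
    unfolding a_def
    by (rule measurable_compose[OF A])
      (intro borel_measurable_continuous_onI continuous_intros)
  have u: "u \<in> borel_measurable M" unfolding u_def by measurable
  have arcsin: "(\<lambda>z. 2 * arcsin (max (- 1) (min 1 (1 / cmod z)))) \<in> borel_measurable borel"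
  proof -
    have "(\<lambda>z :: complex. 1 / cmod z) \<in> borel_measurable borel" by measurable
    from measurable_compose[OF this borel_measurable_clamped_arcsin] show ?thesis by measurable
  qed
  let ?G = "\<lambda>z. 2 * arcsin (max (- 1) (min 1 (1 / cmod z)))"
  let ?r = "\<lambda>\<omega>. of_real (cmod (a \<omega>)) :: complex"
  have [measurable]: "u \<in> borel_measurable M" by (rule u)
  have r: "?r \<in> borel_measurable M" by measurable
  have \<phi>_G: "\<phi> = (\<lambda>\<omega>. ?G (?r \<omega>))" by (simp add: \<phi>_def)
  have \<phi> [measurable]: "\<phi> \<in> borel_measurable M"
    unfolding \<phi>_G by (rule measurable_compose[OF r arcsin])
  have indep: "indep_var borel u borel ?r"
  proof -
    let ?v = "\<lambda>\<omega>. A \<omega> $ 1 $ 2 / of_real (cmod (A \<omega> $ 1 $ 2))"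
    let ?X = "\<lambda>i::nat. [u, ?v, ?r] ! i"
    have "indep_vars (\<lambda>_. borel) ?X {0, 1, 2}"
      using rand by (simp add: random_disk_matrix_def u_def a_def Let_def)
    then have "indep_var (PiM {0} (\<lambda>_. borel)) (\<lambda>\<omega>. restrict (\<lambda>i. ?X i \<omega>) {0})
        (PiM {2} (\<lambda>_. borel)) (\<lambda>\<omega>. restrict (\<lambda>i. ?X i \<omega>) {2})"
      by (rule indep_var_restrict) auto
    moreover have "(\<lambda>f. f i) \<in> measurable (PiM {i :: nat} (\<lambda>_. borel :: complex measure)) borel" for i
      by (rule measurable_component_singleton) simp
    ultimately have "indep_var borel ((\<lambda>f. f 0) \<circ> (\<lambda>\<omega>. restrict (\<lambda>i. ?X i \<omega>) {0}))
        borel ((\<lambda>f. f 2) \<circ> (\<lambda>\<omega>. restrict (\<lambda>i. ?X i \<omega>) {2}))"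
      by (intro indep_var_compose)
    then show ?thesis by (simp add: comp_def)
  qed
  \<comment> \<open>The angle \<open>\<phi>\<close> is a function of \<open>|a|\<close>, so it inherits independence of \<open>u\<close>.\<close>
  have joint: "distr M (borel \<Otimes>\<^sub>M borel) (\<lambda>\<omega>. (u \<omega>, \<phi> \<omega>)) = polar_distribution"
  proof -
    have "distr M borel \<phi> = distr M borel (\<lambda>\<omega>. 2 * arcsin (1 / cmod (a \<omega>)))"
      by (rule distr_cong) (simp_all add: \<phi>_eq)
    then have dist_u: "distr M borel u = circle_uniform"
      and dist_\<phi>: "distr M borel \<phi> = half_turn_uniform"
      using rand by (simp_all add: random_disk_matrix_def u_def a_def Let_def)
    have dist_r: "distr (distr M borel ?r) borel ?G = distr M borel \<phi>"
      unfolding \<phi>_G using distr_distr[OF arcsin r] by (simp add: comp_def)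
    interpret \<phi>: prob_space "distr M borel \<phi>" by (rule prob_space_distr) (rule \<phi>)
    have "distr circle_uniform borel (\<lambda>x. x) \<Otimes>\<^sub>M distr (distr M borel ?r) borel ?G
        = distr (circle_uniform \<Otimes>\<^sub>M distr M borel ?r) (borel \<Otimes>\<^sub>M borel) (\<lambda>(x, z). (x, ?G z))"
    proof (rule pair_measure_distr)
      show "(\<lambda>x. x) \<in> measurable circle_uniform borel" by measurable
      show "?G \<in> measurable (distr M borel ?r) borel"
        using arcsin by (simp add: measurable_distr_eq1)
      show "sigma_finite_measure (distr (distr M borel ?r) borel ?G)"
        unfolding dist_r by unfold_locales
    qed
    moreover have "circle_uniform \<Otimes>\<^sub>M distr M borel ?r
        = distr M (borel \<Otimes>\<^sub>M borel) (\<lambda>\<omega>. (u \<omega>, ?r \<omega>))"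
      using indep indep_var_distribution_eq[of borel u borel ?r] by (simp add: dist_u)
    moreover have "distr (distr M (borel \<Otimes>\<^sub>M borel) (\<lambda>\<omega>. (u \<omega>, ?r \<omega>)))
        (borel \<Otimes>\<^sub>M borel) (\<lambda>(x, z). (x, ?G z)) = distr M (borel \<Otimes>\<^sub>M borel) (\<lambda>\<omega>. (u \<omega>, \<phi> \<omega>))"
    proof -
      note arcsin [measurable]
      have "(\<lambda>(x, z). (x, ?G z)) \<in> measurable (borel \<Otimes>\<^sub>M borel) (borel \<Otimes>\<^sub>M borel)"
        by measurable
      moreover have "(\<lambda>\<omega>. (u \<omega>, ?r \<omega>)) \<in> measurable M (borel \<Otimes>\<^sub>M borel)"
        by measurable
      ultimately show ?thesis by (subst distr_distr) (simp_all add: comp_def \<phi>_G)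
    qed
    ultimately show ?thesis
      by (simp add: dist_r dist_\<phi> distr_id2)
  qed
  have event: "emeasure M {\<omega> \<in> space M. P (u \<omega>, \<phi> \<omega>)} = emeasure polar_distribution {p. P p}"
    if "Measurable.pred (borel \<Otimes>\<^sub>M borel) P" for P
  proof -
    have "{p. P p} \<in> sets (borel \<Otimes>\<^sub>M borel)"
      using predE[OF that] by (simp add: space_pair_measure)
    then show ?thesis
      unfolding joint[symmetric]
      by (subst emeasure_distr) (auto simp: vimage_def intro!: arg_cong[of _ _ "emeasure M"])
  qed
  have mod_u: "(Re (u \<omega>))\<^sup>2 + (Im (u \<omega>))\<^sup>2 = 1" and a_u: "Re (a \<omega>) = cmod (a \<omega>) * Re (u \<omega>)"
    and sin_\<phi>: "sin (\<phi> \<omega> / 2) = 1 / cmod (a \<omega>)"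
    and cos_\<phi>: "0 \<le> cos (\<phi> \<omega> / 2)" if "\<omega> \<in> space M" for \<omega>
  proof -
    have a1: "1 \<le> cmod (a \<omega>)" by (rule mod_a[OF that])
    then have "cmod (u \<omega>) = 1" by (auto simp: u_def norm_divide)
    then show "(Re (u \<omega>))\<^sup>2 + (Im (u \<omega>))\<^sup>2 = 1" by (simp flip: cmod_power2)
    have "a \<omega> = of_real (cmod (a \<omega>)) * u \<omega>" using a1 by (auto simp: u_def)
    from arg_cong[OF this, of Re] show "Re (a \<omega>) = cmod (a \<omega>) * Re (u \<omega>)" by simp
    show "sin (\<phi> \<omega> / 2) = 1 / cmod (a \<omega>)" "0 \<le> cos (\<phi> \<omega> / 2)"
      using inverse_a[OF that] arcsin_bounded[of "1 / cmod (a \<omega>)"]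
      by (auto simp: \<phi>_eq[OF that] intro!: cos_ge_zero)
  qed
  have null: "emeasure M {\<omega> \<in> space M. Re (a \<omega>) = x} = 0" for x
  proof -
    have "{\<omega> \<in> space M. Re (a \<omega>) = x} = {\<omega> \<in> space M. Re (u \<omega>) = x * sin (\<phi> \<omega> / 2)}"
      using a_u sin_\<phi> mod_a by (force simp: field_simps)
    then show ?thesis
      using event[of "\<lambda>p. Re (fst p) = x * sin (snd p / 2)"]
      by (simp add: polar_distribution_null)
  qed
  have E [measurable]: "{\<omega> \<in> space M. x \<le> \<bar>Re (a \<omega>)\<bar>} \<in> sets M"
     "{\<omega> \<in> space M. \<bar>Re (a \<omega>)\<bar> \<le> x} \<in> sets M" for x
    by measurable
  have "emeasure M {\<omega> \<in> space M. 1 \<le> \<bar>Re (a \<omega>)\<bar>} = emeasure M {\<omega> \<in> space M. \<bar>Re (a \<omega>)\<bar> \<le> 1}"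
  proof -
    let ?P = "\<lambda>p. sin (snd p / 2) \<le> \<bar>Re (fst p)\<bar>" and ?T = "\<lambda>(u :: complex, s). (\<i> * u, pi - s)"
    have "{\<omega> \<in> space M. 1 \<le> \<bar>Re (a \<omega>)\<bar>} = {\<omega> \<in> space M. ?P (u \<omega>, \<phi> \<omega>)}"
    proof -
      have "1 \<le> \<bar>Re (a \<omega>)\<bar> \<longleftrightarrow> ?P (u \<omega>, \<phi> \<omega>)" if w: "\<omega> \<in> space M" for \<omega>
      proof -
        have "0 < cmod (a \<omega>)" using mod_a[OF w] by linarith
        then show ?thesis
          by (simp add: a_u[OF w] sin_\<phi>[OF w] abs_mult pos_divide_le_eq mult.commute)
      qed
      then show ?thesis by blast
    qed
    then have "emeasure M {\<omega> \<in> space M. 1 \<le> \<bar>Re (a \<omega>)\<bar>} = emeasure polar_distribution {p. ?P p}"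
      using event[of ?P] by simp
    also have "\<dots> = emeasure (distr polar_distribution (borel \<Otimes>\<^sub>M lborel) ?T) {p. ?P p}"
      by (simp only: polar_distribution_symmetric)
    also have "\<dots> = emeasure polar_distribution {p. ?P (?T p)}"
    proof (subst emeasure_distr)
      show "?T \<in> measurable polar_distribution (borel \<Otimes>\<^sub>M lborel)" by measurable
      have "Measurable.pred (borel \<Otimes>\<^sub>M lborel) ?P" by measurable
      from predE[OF this] show "{p. ?P p} \<in> sets (borel \<Otimes>\<^sub>M lborel)"
        by (simp add: space_pair_measure)
    qed (auto simp: vimage_def space_pair_measure sets_eq_imp_space_eq[OF sets_circle_uniform])
    also have "\<dots> = emeasure M {\<omega> \<in> space M. ?P (?T (u \<omega>, \<phi> \<omega>))}"
      by (rule event[symmetric]) (simp add: case_prod_beta)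
    also have "{\<omega> \<in> space M. ?P (?T (u \<omega>, \<phi> \<omega>))} = {\<omega> \<in> space M. \<bar>Re (a \<omega>)\<bar> \<le> 1}"
    proof -
      have "?P (?T (u \<omega>, \<phi> \<omega>)) \<longleftrightarrow> \<bar>Re (a \<omega>)\<bar> \<le> 1" if w: "\<omega> \<in> space M" for \<omega>
      proof -
        have "?P (?T (u \<omega>, \<phi> \<omega>)) \<longleftrightarrow> cos (\<phi> \<omega> / 2) \<le> \<bar>Im (u \<omega>)\<bar>"
          by (simp add: diff_divide_distrib sin_diff)
        also have "\<dots> \<longleftrightarrow> (cos (\<phi> \<omega> / 2))\<^sup>2 \<le> (Im (u \<omega>))\<^sup>2"
          using cos_\<phi>[OF w] abs_le_square_iff[of "cos (\<phi> \<omega> / 2)" "Im (u \<omega>)"] by simp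
        also have "\<dots> \<longleftrightarrow> (Re (u \<omega>))\<^sup>2 \<le> (sin (\<phi> \<omega> / 2))\<^sup>2"
          using mod_u[OF w] sin_cos_squared_add[of "\<phi> \<omega> / 2"] by linarith
        also have "\<dots> \<longleftrightarrow> \<bar>Re (u \<omega>)\<bar> \<le> sin (\<phi> \<omega> / 2)"
          using sin_\<phi>[OF w] abs_le_square_iff[of "Re (u \<omega>)" "sin (\<phi> \<omega> / 2)"] by simp
        also have "\<dots> \<longleftrightarrow> \<bar>Re (a \<omega>)\<bar> \<le> 1"
        proof -
          have "0 < cmod (a \<omega>)" using mod_a[OF w] by linarith
          then show ?thesis
            by (simp add: a_u[OF w] sin_\<phi>[OF w] abs_mult pos_le_divide_eq mult.commute)
        qed
        finally show ?thesis .
      qed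
      then show ?thesis by blast
    qed
    finally show ?thesis .
  qed
  then have sym: "prob {\<omega> \<in> space M. 1 \<le> \<bar>Re (a \<omega>)\<bar>} = prob {\<omega> \<in> space M. \<bar>Re (a \<omega>)\<bar> \<le> 1}"
    by (simp add: measure_def)
  \<comment> \<open>The set \<open>C\<close> contains \<open>1\<close> and \<open>-1\<close>, so that the overlap of the two symmetric events is null.\<close>
  obtain C where C: "countable C" "1 \<in> C" "- 1 \<in> C" "discrete_half_traces = {x. 1 \<le> \<bar>x\<bar>} \<union> C"
    by (rule discrete_half_traces_cases)
  let ?N = "{\<omega> \<in> space M. Re (a \<omega>) \<in> C}"
  have N: "?N \<in> null_sets M"
  proof -
    have "{\<omega> \<in> space M. Re (a \<omega>) = x} \<in> null_sets M" for x
      using null[of x] by (intro null_setsI) measurable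
    then have "(\<Union>x\<in>C. {\<omega> \<in> space M. Re (a \<omega>) = x}) \<in> null_sets M"
      by (intro null_sets_UN' C(1))
    moreover have "(\<Union>x\<in>C. {\<omega> \<in> space M. Re (a \<omega>) = x}) = ?N" by blast
    ultimately show ?thesis by simp
  qed
  have S: "{\<omega> \<in> space M. Re (A \<omega> $ 1 $ 1) \<in> discrete_half_traces}
      = {\<omega> \<in> space M. 1 \<le> \<bar>Re (a \<omega>)\<bar>} \<union> ?N"
    by (auto simp: C(4) a_def)
  have "prob ({\<omega> \<in> space M. 1 \<le> \<bar>Re (a \<omega>)\<bar>} \<union> ?N) = prob {\<omega> \<in> space M. 1 \<le> \<bar>Re (a \<omega>)\<bar>}"
    by (rule measure_Un_null_set[OF E(1) N])
  moreover have "prob {\<omega> \<in> space M. \<bar>Re (a \<omega>)\<bar> \<le> 1} = 1 - prob {\<omega> \<in> space M. 1 \<le> \<bar>Re (a \<omega>)\<bar>}"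
  proof -
    have cover: "{\<omega> \<in> space M. \<bar>Re (a \<omega>)\<bar> \<le> 1}
        = (space M - {\<omega> \<in> space M. 1 \<le> \<bar>Re (a \<omega>)\<bar>}) \<union> ({\<omega> \<in> space M. \<bar>Re (a \<omega>)\<bar> \<le> 1} \<inter> ?N)"
    proof -
      have "\<bar>x\<bar> \<le> 1 \<longleftrightarrow> \<not> 1 \<le> \<bar>x\<bar> \<or> (\<bar>x\<bar> \<le> 1 \<and> x \<in> C)" for x
      proof (cases "x = 1 \<or> x = - 1")
        case True
        then show ?thesis using C(2,3) by auto
      next
        case False
        then have "\<bar>x\<bar> \<noteq> 1" by linarith
        then show ?thesis by auto
      qed
      then show ?thesis by blast
    qed
    have "{\<omega> \<in> space M. \<bar>Re (a \<omega>)\<bar> \<le> 1} \<inter> ?N \<in> null_sets M"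
      by (rule null_set_Int1[OF N E(2)])
    moreover have "space M - {\<omega> \<in> space M. 1 \<le> \<bar>Re (a \<omega>)\<bar>} \<in> sets M"
      using E(1) by (rule sets.compl_sets)
    ultimately have "prob {\<omega> \<in> space M. \<bar>Re (a \<omega>)\<bar> \<le> 1}
        = prob (space M - {\<omega> \<in> space M. 1 \<le> \<bar>Re (a \<omega>)\<bar>})"
      by (subst cover) (rule measure_Un_null_set)
    then show ?thesis using prob_compl[OF E(1)] by simp
  qed
  ultimately show ?thesis unfolding S using sym by linarith
qed


section \<open>The bound\<close>

theorem corollary4p6:
  fixes M :: "'w measure" and A B :: "'w \<Rightarrow> cmat2" and f g :: "'w \<Rightarrow> cmat2 set"
  assumes "prob_space M"
    and "random_disk_matrix M A" and "random_disk_matrix M B"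
    and "prob_space.indep_var M borel A borel B"
    and "\<And>\<omega>. \<omega> \<in> space M \<Longrightarrow> f \<omega> = to_PSL2C (A \<omega>)"
    and "\<And>\<omega>. \<omega> \<in> space M \<Longrightarrow> g \<omega> = to_PSL2C (B \<omega>)"
  shows "{\<omega> \<in> space M. discrete_in_PSL2C (generate PSL2C {f \<omega>, g \<omega>})} \<in> sets M
    \<and> measure M {\<omega> \<in> space M. discrete_in_PSL2C (generate PSL2C {f \<omega>, g \<omega>})} \<le> 1 / 4"
proof
  interpret prob_space M by fact
  have disk: "A \<omega> \<in> disk_matrices" "B \<omega> \<in> disk_matrices" if "\<omega> \<in> space M" for \<omega>
    using that assms(2,3) by (simp_all add: random_disk_matrix_def)
  have [measurable]: "A \<in> borel_measurable M" "B \<in> borel_measurable M"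
    using assms(2,3) by (simp_all add: random_disk_matrix_def)
  let ?D = "{\<omega> \<in> space M. discrete_in_PSL2C (generate PSL2C {f \<omega>, g \<omega>})}"
  have "?D = {\<omega> \<in> space M. discrete_in_PSL2C (generate PSL2C {to_PSL2C (A \<omega>), to_PSL2C (B \<omega>)})}"
    using assms(5,6) by auto
  also have "\<dots> \<in> sets M"
    using disk disk_matrices_subset by (intro sets_discrete_generate) auto
  finally show "?D \<in> sets M" .
  define H where "H = {X :: cmat2. Re (X $ 1 $ 1) \<in> discrete_half_traces}"
  have "(\<lambda>X :: cmat2. Re (X $ 1 $ 1)) \<in> borel_measurable borel"
    by (intro borel_measurable_continuous_onI continuous_intros)
  from measurable_sets[OF this sets_discrete_half_traces]
  have H: "H \<in> sets borel" by (simp add: H_def vimage_def)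
  have sub: "?D \<subseteq> (\<lambda>\<omega>. (A \<omega>, B \<omega>)) -` (H \<times> H) \<inter> space M"
  proof
    fix \<omega> assume "\<omega> \<in> ?D"
    then have \<omega>: "\<omega> \<in> space M"
      and discrete: "discrete_in_PSL2C (generate PSL2C {to_PSL2C (A \<omega>), to_PSL2C (B \<omega>)})"
      using assms(5,6) by auto
    have "{to_PSL2C (A \<omega>), to_PSL2C (B \<omega>)} \<subseteq> carrier PSL2C"
      using disk[OF \<omega>] disk_matrices_subset by (auto simp: carrier_PSL2C)
    then have "subgroup (generate PSL2C {to_PSL2C (A \<omega>), to_PSL2C (B \<omega>)}) PSL2C"
      by (rule group.generate_is_subgroup[OF group_PSL2C])
    then have "A \<omega> \<in> H" "B \<omega> \<in> H"
      using half_trace_if_discrete[OF _ discrete] disk[OF \<omega>]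
      by (auto simp: H_def intro: generate.incl)
    then show "\<omega> \<in> (\<lambda>\<omega>. (A \<omega>, B \<omega>)) -` (H \<times> H) \<inter> space M" using \<omega> by simp
  qed
  have "(\<lambda>\<omega>. (A \<omega>, B \<omega>)) -` (H \<times> H) \<inter> space M = (A -` H \<inter> space M) \<inter> (B -` H \<inter> space M)"
    by auto
  then have "(\<lambda>\<omega>. (A \<omega>, B \<omega>)) -` (H \<times> H) \<inter> space M \<in> sets M"
    using H by (simp add: measurable_sets sets.Int)
  with sub have "prob ?D \<le> prob ((\<lambda>\<omega>. (A \<omega>, B \<omega>)) -` (H \<times> H) \<inter> space M)"
    by (rule finite_measure_mono)
  also have "\<dots> = prob (A -` H \<inter> space M) * prob (B -` H \<inter> space M)"
    using assms(4) H by (intro indep_varD)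
  also have "prob (A -` H \<inter> space M) = 1 / 2"
    using prob_discrete_half_traces[OF \<open>prob_space M\<close> assms(2)]
    by (simp add: H_def vimage_def Int_def conj_commute)
  also have "prob (B -` H \<inter> space M) = 1 / 2"
    using prob_discrete_half_traces[OF \<open>prob_space M\<close> assms(3)]
    by (simp add: H_def vimage_def Int_def conj_commute)
  finally show "prob ?D \<le> 1 / 4" by simp
qed

end
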